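(* Suppose there are no missing or duplicate rankings. Let $v_s^{RR}$ denote the rank reciprocal weight of the attribute ranked $s$ under expert $i$, given by $v_s^{RR}=1\Big/\Big(s_{ij}\sum_{q=1}^J\frac1q\Big)$, where $j$ is the attribute with $s_{ij}=s$. Then the optimal weight $w^*_{is}$ of the attribute ranked $s$ under expert $i$ in the Ordinal Priority Approach (OPA) can be determined by $$w^*_{is}=\frac{v_s^{RR}}{t_i\big(\sum_{p=1}^I\frac1p\big)},\qquad\forall i\in[I],\ s\in[J],$$ which implies that the rank reciprocal weight is a special case of OPA for determining the weights of attributes when the importance of experts is equal.
   Context: $[n]=\{1,\dots,n\}$. There are $I$ experts, $J$ attributes and $K$ alternatives. $t_i\in[I]$ is the rank of expert $i$, $s_{ij}\in[J]$ is the rank of attribute $j$ given by expert $i$, and each expert ranks the $K$ alternatives under each attribute (rank 1 is the most important). No missing or duplicate rankings means that $(t_i)_{i\in[I]}$ is a permutation of $[I]$, that for each $i$ $(s_{ij})_{j\in[J]}$ is a permutation of $[J]$, and that for each $(i,j)$ the alternatives receive each of the ranks $1,\dots,K$ exactly once. In this case the OPA model is the linear program in $z$ and $\mathbf w=(w_{ijr})$: $$\max z\ \text{ s.t. }\Big(\sum_{h=r}^{K}\tfrac1h\Big)z\le t_is_{ij}w_{ijr}\ \ \forall i,j,r,\quad\sum_{i=1}^I\sum_{j=1}^J\sum_{r=1}^Kw_{ijr}=1,\quad w_{ijr}\ge0\ \ \forall i,j,r,$$ where $w_{ijr}$ is the weight of the alternative ranked $r$ under expert $i$ and attribute $j$;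 $w^*_{ijr}$ denotes its optimal solution. The optimal weight of the attribute ranked $s$ under expert $i$ is $w^*_{is}=\sum_{r=1}^Kw^*_{ijr}$, where $j$ is the attribute with $s_{ij}=s$. *)

theory Defs
  imports Complex_Main
begin

text \<open>
  \<open>t i\<close> is the rank of expert \<open>i\<close>, \<open>s i j\<close> the rank expert \<open>i\<close> gives to attribute \<open>j\<close>, and
  \<open>a i j k\<close> the rank expert \<open>i\<close> gives to alternative \<open>k\<close> under attribute \<open>j\<close>; only the values at
  indices in \<open>{1..I}\<close>, \<open>{1..J}\<close>, \<open>{1..K}\<close> are meaningful.
\<close>

definition complete_rankings ::
  "nat \<Rightarrow> nat \<Rightarrow> nat \<Rightarrow> (nat \<Rightarrow> nat) \<Rightarrow> (nat \<Rightarrow> nat \<Rightarrow> nat) \<Rightarrow> (nat \<Rightarrow> nat \<Rightarrow> nat \<Rightarrow> nat) \<Rightarrow> bool" where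
  "complete_rankings I J K t s a \<longleftrightarrow>
     bij_betw t {1..I} {1..I} \<and>
     (\<forall>i\<in>{1..I}. bij_betw (s i) {1..J} {1..J}) \<and>
     (\<forall>i\<in>{1..I}. \<forall>j\<in>{1..J}. bij_betw (a i j) {1..K} {1..K})"

text \<open>
  In the linear program, \<open>w i j r\<close> is indexed by the rank \<open>r\<close> of the alternative and not by the
  alternative itself, so the rankings \<open>a\<close> do not occur in it. The variable \<open>z\<close> is unrestricted in sign.
\<close>

definition opa_feasible ::
  "nat \<Rightarrow> nat \<Rightarrow> nat \<Rightarrow> (nat \<Rightarrow> nat) \<Rightarrow> (nat \<Rightarrow> nat \<Rightarrow> nat) \<Rightarrow>
   real \<Rightarrow> (nat \<Rightarrow> nat \<Rightarrow> nat \<Rightarrow> real) \<Rightarrow> bool" where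
  "opa_feasible I J K t s z w \<longleftrightarrow>
     (\<forall>i\<in>{1..I}. \<forall>j\<in>{1..J}. \<forall>r\<in>{1..K}.
        (\<Sum>h=r..K. 1 / real h) * z \<le> real (t i) * real (s i j) * w i j r) \<and>
     (\<Sum>i=1..I. \<Sum>j=1..J. \<Sum>r=1..K. w i j r) = 1 \<and>
     (\<forall>i\<in>{1..I}. \<forall>j\<in>{1..J}. \<forall>r\<in>{1..K}. 0 \<le> w i j r)"

definition opa_optimal ::
  "nat \<Rightarrow> nat \<Rightarrow> nat \<Rightarrow> (nat \<Rightarrow> nat) \<Rightarrow> (nat \<Rightarrow> nat \<Rightarrow> nat) \<Rightarrow>
   real \<Rightarrow> (nat \<Rightarrow> nat \<Rightarrow> nat \<Rightarrow> real) \<Rightarrow> bool" where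
  "opa_optimal I J K t s z w \<longleftrightarrow>
     opa_feasible I J K t s z w \<and>
     (\<forall>z' w'. opa_feasible I J K t s z' w' \<longrightarrow> z' \<le> z)"

definition attribute_ranked :: "nat \<Rightarrow> (nat \<Rightarrow> nat \<Rightarrow> nat) \<Rightarrow> nat \<Rightarrow> nat \<Rightarrow> nat" where
  "attribute_ranked J s i \<sigma> = (THE j. j \<in> {1..J} \<and> s i j = \<sigma>)"

definition attribute_weight ::
  "nat \<Rightarrow> nat \<Rightarrow> (nat \<Rightarrow> nat \<Rightarrow> nat) \<Rightarrow> (nat \<Rightarrow> nat \<Rightarrow> nat \<Rightarrow> real) \<Rightarrow> nat \<Rightarrow> nat \<Rightarrow> real" where
  "attribute_weight J K s w i \<sigma> = (\<Sum>r=1..K. w i (attribute_ranked J s i \<sigma>) r)"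

definition rr_weight :: "nat \<Rightarrow> (nat \<Rightarrow> nat \<Rightarrow> nat) \<Rightarrow> nat \<Rightarrow> nat \<Rightarrow> real" where
  "rr_weight J s i \<sigma> =
     1 / (real (s i (attribute_ranked J s i \<sigma>)) * (\<Sum>q=1..J. 1 / real q))"

text \<open>
  Equal ranks for at least two experts are duplicates, so this excludes
  \<^const>\<open>complete_rankings\<close> unless \<open>I \<le> 1\<close>; the linear program itself makes sense for such ranks.
\<close>

definition equal_experts :: "nat \<Rightarrow> (nat \<Rightarrow> nat) \<Rightarrow> bool" where
  "equal_experts I t \<longleftrightarrow>
     (\<forall>i\<in>{1..I}. t i \<in> {1..I}) \<and> (\<forall>i\<in>{1..I}. \<forall>i'\<in>{1..I}. t i = t i')"

end

theory Submission
  imports Defs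
begin

text \<open>
  Put \<open>b\<^sub>i\<^sub>j\<^sub>r = (\<Sum>h=r..K. 1/h) / (t\<^sub>i s\<^sub>i\<^sub>j)\<close> and \<open>S = \<Sum>b\<^sub>i\<^sub>j\<^sub>r\<close>. The rank constraints say \<open>z b \<le> w\<close>, and
  summing them gives \<open>z S \<le> 1\<close>. The pair \<open>z = 1/S\<close>, \<open>w = b/S\<close> attains this bound, and in
  any optimal solution all the constraints are tight because their sum is. As
  \<open>\<Sum>\<^sub>r \<Sum>h=r..K. 1/h = K\<close>, the factor \<open>K\<close> cancels from the attribute weights. The argument needs
  only that the expert ranks are positive, so it covers equal experts as well.
\<close>

text \<open>The term \<open>1 / h\<close> occurs in exactly the tails with
  \<open>r = 1, ..., h\<close>, so it contributes 1 in total. In the induction, the new term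
  \<open>1 / (K + 1)\<close> is added to each of the \<open>K\<close> old tails and forms one new
  tail by itself, which also gives 1.\<close>

lemma sum_harmonic_tails: "(\<Sum>r=1..K. \<Sum>h=r..K. 1 / real h) = real K"
proof (induction K)
  case (Suc K)
  have "(\<Sum>r=1..Suc K. \<Sum>h=r..Suc K. 1 / real h)
      = (\<Sum>r=1..K. \<Sum>h=r..Suc K. 1 / real h) + 1 / real (Suc K)"
    by simp
  also have "(\<Sum>r=1..K. \<Sum>h=r..Suc K. 1 / real h)
      = (\<Sum>r=1..K. (\<Sum>h=r..K. 1 / real h) + 1 / real (Suc K))"
    by (intro sum.cong) auto
  also have "\<dots> = real K + real K / real (Suc K)"
    using Suc.IH by (simp add: sum.distrib)
  finally show ?case
    by (simp add: field_simps)
qed simp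

lemma harmonic_sum_pos:
  assumes "1 \<le> n"
  shows "0 < (\<Sum>q=1..n. 1 / real q)"
  using assms by (intro sum_pos) auto

lemma sum_inverse_bij_betw:
  assumes "bij_betw f {1..n} {1..n}"
  shows "(\<Sum>i=1..n. 1 / real (f i)) = (\<Sum>q=1..n. 1 / real q)"
  using sum.reindex_bij_betw[OF assms, of "\<lambda>q. 1 / real q"] .

lemma bij_betw_interval_pos:
  fixes f :: "nat \<Rightarrow> nat"
  assumes "bij_betw f {1..n} {1..n}" "i \<in> {1..n}"
  shows "0 < f i"
  using bij_betw_apply[OF assms] by simp

text \<open>Surjectivity of the ranking gives existence and injectivity gives uniqueness, so the
  definite description denotes the intended attribute.\<close>

lemma attribute_ranked:
  assumes "bij_betw (s i) {1..J} {1..J}" "\<sigma> \<in> {1..J}"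
  shows "attribute_ranked J s i \<sigma> \<in> {1..J}" "s i (attribute_ranked J s i \<sigma>) = \<sigma>"
proof -
  have "\<sigma> \<in> s i ` {1..J}"
    using assms(2) by (simp only: bij_betw_imp_surj_on[OF assms(1)])
  then obtain j where j: "j \<in> {1..J}" "s i j = \<sigma>"
    by (elim imageE) simp
  have "\<exists>!j. j \<in> {1..J} \<and> s i j = \<sigma>"
  proof (rule ex1I[of _ j])
    show "k = j" if "k \<in> {1..J} \<and> s i k = \<sigma>" for k
      using inj_onD[OF bij_betw_imp_inj_on[OF assms(1)], of k j] that j by simp
  qed (use j in simp)
  then have "attribute_ranked J s i \<sigma> \<in> {1..J} \<and> s i (attribute_ranked J s i \<sigma>) = \<sigma>"
    unfolding attribute_ranked_def by (rule theI')
  then show "attribute_ranked J s i \<sigma> \<in> {1..J}" "s i (attribute_ranked J s i \<sigma>) = \<sigma>"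
    by simp_all
qed

text \<open>The selected attribute has rank \<open>\<sigma>\<close> by construction, so the value is
  the same for every expert. This independence makes the weights of different experts summable in
  the case of equal experts.\<close>

lemma rr_weight_eq:
  assumes "bij_betw (s i) {1..J} {1..J}" "\<sigma> \<in> {1..J}"
  shows "rr_weight J s i \<sigma> = 1 / (real \<sigma> * (\<Sum>q=1..J. 1 / real q))"
  by (simp add: rr_weight_def attribute_ranked(2)[of s, OF assms])

lemma mult_le_mult_iff_divide:
  fixes d x z c :: real
  assumes "0 < d"
  shows "c * z \<le> d * x \<longleftrightarrow> c / d * z \<le> x"
  using pos_divide_le_eq[OF assms, of "c * z" x] by (simp add: mult.commute)

text \<open>Positivity is the common ground of the two interpretations made below: expert ranks that
  form a permutation, and expert ranks that all coincide.\<close>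

locale opa_ranks =
  fixes I J K :: nat and t :: "nat \<Rightarrow> nat" and s :: "nat \<Rightarrow> nat \<Rightarrow> nat"
  assumes I: "1 \<le> I" and J: "1 \<le> J" and K: "1 \<le> K"
    and t_pos: "i \<in> {1..I} \<Longrightarrow> 0 < t i"
    and s_bij: "i \<in> {1..I} \<Longrightarrow> bij_betw (s i) {1..J} {1..J}"
begin

definition bound :: "nat \<Rightarrow> nat \<Rightarrow> nat \<Rightarrow> real" where
  "bound i j r = (\<Sum>h=r..K. 1 / real h) / (real (t i) * real (s i j))"

text \<open>The closed form of the sum of all \<open>bound i j r\<close>. The sum of
  \<open>1 / real (t i)\<close> is left unevaluated: it is a harmonic number when \<open>t\<close>
  is a permutation, and \<open>I\<close> divided by the common rank when all ranks are
  equal.\<close>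

definition total :: real where
  "total = real K * (\<Sum>i=1..I. 1 / real (t i)) * (\<Sum>q=1..J. 1 / real q)"

lemma sum_bound_rank: "(\<Sum>r=1..K. bound i j r) = real K / (real (t i) * real (s i j))"
  by (simp only: bound_def sum_harmonic_tails flip: sum_divide_distrib)

lemma sum_bound: "(\<Sum>i=1..I. \<Sum>j=1..J. \<Sum>r=1..K. bound i j r) = total"
proof -
  have "(\<Sum>i=1..I. \<Sum>j=1..J. \<Sum>r=1..K. bound i j r)
      = (\<Sum>i=1..I. real K * (1 / real (t i)) * (\<Sum>j=1..J. 1 / real (s i j)))"
    unfolding sum_bound_rank by (simp add: sum_distrib_left)
  \<comment> \<open>Each expert permutes the ranks \<open>1, ..., J\<close>, so the inner sum is the
    same harmonic number for all experts and factors out.\<close>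
  also have "\<dots> = (\<Sum>i=1..I. real K * (1 / real (t i)) * (\<Sum>q=1..J. 1 / real q))"
    by (intro sum.cong refl) (simp only: sum_inverse_bij_betw[OF s_bij])
  also have "\<dots> = total"
    by (simp only: total_def flip: sum_distrib_left sum_distrib_right)
  finally show ?thesis .
qed

lemma total_pos: "0 < total"
proof -
  have "0 < (\<Sum>i=1..I. 1 / real (t i))"
    using I t_pos by (intro sum_pos) auto
  then show ?thesis
    using harmonic_sum_pos[OF J] K unfolding total_def by (intro mult_pos_pos) auto
qed

lemma rank_constraint_iff:
  assumes "i \<in> {1..I}" "j \<in> {1..J}"
  shows "(\<Sum>h=r..K. 1 / real h) * z \<le> real (t i) * real (s i j) * x \<longleftrightarrow> bound i j r * z \<le> x"
proof -
  have "0 < real (t i) * real (s i j)"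
    using t_pos[OF assms(1)] bij_betw_interval_pos[OF s_bij[OF assms(1)] assms(2)] by simp
  then show ?thesis
    unfolding bound_def by (rule mult_le_mult_iff_divide)
qed

lemma feasible_bound:
  assumes "opa_feasible I J K t s z w" "i \<in> {1..I}" "j \<in> {1..J}" "r \<in> {1..K}"
  shows "bound i j r * z \<le> w i j r"
  using assms rank_constraint_iff[OF assms(2,3)] unfolding opa_feasible_def by blast

lemma feasible_le:
  assumes "opa_feasible I J K t s z w"
  shows "total * z \<le> 1"
proof -
  have "total * z = (\<Sum>i=1..I. \<Sum>j=1..J. \<Sum>r=1..K. bound i j r * z)"
    by (simp only: sum_distrib_right flip: sum_bound)
  also have "\<dots> \<le> (\<Sum>i=1..I. \<Sum>j=1..J. \<Sum>r=1..K. w i j r)"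
    by (intro sum_mono feasible_bound[OF assms])
  also have "\<dots> = 1"
    using assms by (simp add: opa_feasible_def)
  finally show ?thesis .
qed

lemma optimal_attained: "opa_optimal I J K t s (1 / total) (\<lambda>i j r. bound i j r / total)"
proof -
  have "(\<Sum>i=1..I. \<Sum>j=1..J. \<Sum>r=1..K. bound i j r / total) = 1"
    using total_pos by (simp only: sum_bound flip: sum_divide_distrib) simp
  moreover have "0 \<le> bound i j r / total" for i j r
    using total_pos by (simp add: bound_def sum_nonneg)
  \<comment> \<open>The candidate meets every rank constraint with equality.\<close>
  moreover have "(\<Sum>h=r..K. 1 / real h) * (1 / total)
      \<le> real (t i) * real (s i j) * (bound i j r / total)"
    if "i \<in> {1..I}" "j \<in> {1..J}" for i j r
    unfolding rank_constraint_iff[OF that] by simp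
  ultimately have "opa_feasible I J K t s (1 / total) (\<lambda>i j r. bound i j r / total)"
    unfolding opa_feasible_def by blast
  moreover have "z \<le> 1 / total" if "opa_feasible I J K t s z w" for z w
    using feasible_le[OF that] total_pos by (simp add: field_simps)
  ultimately show ?thesis
    unfolding opa_optimal_def by blast
qed

lemma optimal_unique:
  assumes opt: "opa_optimal I J K t s z w"
    and ijr: "i \<in> {1..I}" "j \<in> {1..J}" "r \<in> {1..K}"
  shows "w i j r = bound i j r / total"
proof -
  let ?A = "{1..I} \<times> {1..J} \<times> {1..K}"
  have feas: "opa_feasible I J K t s z w"
    using opt by (simp add: opa_optimal_def)
  \<comment> \<open>Comparison with the explicit solution bounds \<open>z\<close> from below;
    \<open>feasible_le\<close> gives the same bound from above.\<close>
  have "1 / total \<le> z"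
    using opt optimal_attained unfolding opa_optimal_def by blast
  with feasible_le[OF feas] total_pos have z: "z = 1 / total"
    by (simp add: field_simps)
  \<comment> \<open>The triple sum is flattened to a single sum over \<open>?A\<close>, the form in
    which \<open>sum_mono_inv\<close> applies: equal sums with termwise inequality have equal
    terms.\<close>
  have "(\<Sum>(i, j, r)\<in>?A. bound i j r * z) = (\<Sum>i=1..I. \<Sum>j=1..J. \<Sum>r=1..K. bound i j r * z)"
    by (simp add: sum.cartesian_product)
  also have "\<dots> = total * z"
    by (simp only: sum_distrib_right flip: sum_bound)
  \<comment> \<open>Both sides are 1, the left by the value of \<open>z\<close> and the right by the
    normalization of the weights.\<close>
  also have "\<dots> = (\<Sum>(i, j, r)\<in>?A. w i j r)"
    using feas total_pos by (simp add: opa_feasible_def sum.cartesian_product z)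
  finally have "(\<lambda>(i, j, r). bound i j r * z) (i, j, r) = (\<lambda>(i, j, r). w i j r) (i, j, r)"
    by (rule sum_mono_inv) (use feasible_bound[OF feas] ijr in auto)
  then show ?thesis
    by (simp add: z)
qed

lemma attribute_weight_optimal:
  assumes opt: "opa_optimal I J K t s z w" and i: "i \<in> {1..I}" and \<sigma>: "\<sigma> \<in> {1..J}"
  shows "attribute_weight J K s w i \<sigma>
    = rr_weight J s i \<sigma> / (real (t i) * (\<Sum>p=1..I. 1 / real (t p)))"
proof -
  let ?j = "attribute_ranked J s i \<sigma>"
  note j = attribute_ranked[of s, OF s_bij[OF i] \<sigma>]
  have "attribute_weight J K s w i \<sigma> = (\<Sum>r=1..K. bound i ?j r / total)"
    unfolding attribute_weight_def
    by (intro sum.cong refl optimal_unique[OF opt i j(1)])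
  also have "\<dots> = real K / (real (t i) * real \<sigma>) / total"
    by (simp only: sum_bound_rank j(2) flip: sum_divide_distrib)
  also have "\<dots> = rr_weight J s i \<sigma> / (real (t i) * (\<Sum>p=1..I. 1 / real (t p)))"
    using K by (simp add: total_def rr_weight_eq[of s, OF s_bij[OF i] \<sigma>])
  finally show ?thesis .
qed

end

theorem corollary2:
  fixes I J K :: nat
    and t :: "nat \<Rightarrow> nat"
    and s :: "nat \<Rightarrow> nat \<Rightarrow> nat"
    and a :: "nat \<Rightarrow> nat \<Rightarrow> nat \<Rightarrow> nat"
  assumes "1 \<le> I" and "1 \<le> J" and "1 \<le> K"
    and "complete_rankings I J K t s a"
  shows "(\<exists>z w. opa_optimal I J K t s z w) \<and>
    (\<forall>z w. opa_optimal I J K t s z w \<longrightarrow>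
       (\<forall>i\<in>{1..I}. \<forall>\<sigma>\<in>{1..J}.
          attribute_weight J K s w i \<sigma> =
            rr_weight J s i \<sigma> / (real (t i) * (\<Sum>p=1..I. 1 / real p)))) \<and>
    (\<forall>t'. equal_experts I t' \<longrightarrow>
       (\<exists>z w. opa_optimal I J K t' s z w) \<and>
       (\<forall>z w. opa_optimal I J K t' s z w \<longrightarrow>
          (\<forall>i\<in>{1..I}. \<forall>\<sigma>\<in>{1..J}.
             attribute_weight J K s w i \<sigma> = rr_weight J s i \<sigma> / real I \<and>
             (\<Sum>p=1..I. attribute_weight J K s w p \<sigma>) = rr_weight J s i \<sigma>)))"
proof -
  have t: "bij_betw t {1..I} {1..I}" and s: "\<And>i. i \<in> {1..I} \<Longrightarrow> bij_betw (s i) {1..J} {1..J}"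
    using assms(4) by (auto simp: complete_rankings_def)
  interpret opa_ranks I J K t s
    by unfold_locales (use assms(1-3) bij_betw_interval_pos[OF t] s in auto)
  have "attribute_weight J K s w i \<sigma> = rr_weight J s i \<sigma> / (real (t i) * (\<Sum>p=1..I. 1 / real p))"
    if "opa_optimal I J K t s z w" "i \<in> {1..I}" "\<sigma> \<in> {1..J}" for z w i \<sigma>
    using attribute_weight_optimal[OF that] by (simp only: sum_inverse_bij_betw[OF t])
  moreover have "\<exists>z w. opa_optimal I J K t s z w"
    using optimal_attained by blast
  moreover have "(\<exists>z w. opa_optimal I J K t' s z w) \<and>
       (\<forall>z w. opa_optimal I J K t' s z w \<longrightarrow>
          (\<forall>i\<in>{1..I}. \<forall>\<sigma>\<in>{1..J}.
             attribute_weight J K s w i \<sigma> = rr_weight J s i \<sigma> / real I \<and>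
             (\<Sum>p=1..I. attribute_weight J K s w p \<sigma>) = rr_weight J s i \<sigma>))"
    if equal: "equal_experts I t'" for t'
  proof -
    have t'_pos: "0 < t' i" if "i \<in> {1..I}" for i
    proof -
      have "t' i \<in> {1..I}"
        using equal that unfolding equal_experts_def by blast
      then show ?thesis
        by simp
    qed
    interpret eq: opa_ranks I J K t' s
      by unfold_locales (use assms(1-3) t'_pos s in auto)
    have weight: "attribute_weight J K s w i \<sigma> = rr_weight J s i \<sigma> / real I"
      if opt: "opa_optimal I J K t' s z w" and i: "i \<in> {1..I}" and \<sigma>: "\<sigma> \<in> {1..J}" for z w i \<sigma>
    proof -
      \<comment> \<open>With a common rank the sum is \<open>I / t' i\<close>; multiplied by
        \<open>t' i\<close> it leaves only \<open>I\<close> in the denominator of the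
        weight.\<close>
      have "(\<Sum>p=1..I. 1 / real (t' p)) = (\<Sum>p=1..I. 1 / real (t' i))"
        using equal i by (intro sum.cong refl) (metis equal_experts_def)
      then have "real (t' i) * (\<Sum>p=1..I. 1 / real (t' p)) = real I"
        using t'_pos[OF i] by simp
      then show ?thesis
        using eq.attribute_weight_optimal[OF opt i \<sigma>] by simp
    qed
    have "(\<Sum>p=1..I. attribute_weight J K s w p \<sigma>) = rr_weight J s i \<sigma>"
      if opt: "opa_optimal I J K t' s z w" and i: "i \<in> {1..I}" and \<sigma>: "\<sigma> \<in> {1..J}" for z w i \<sigma>
    proof -
      \<comment> \<open>By \<open>rr_weight_eq\<close> the summand for expert \<open>p\<close> may
        be written with the fixed expert \<open>i\<close>, so the sum has \<open>I\<close> equal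
        terms.\<close>
      have "(\<Sum>p=1..I. attribute_weight J K s w p \<sigma>) = (\<Sum>p=1..I. rr_weight J s i \<sigma> / real I)"
        using i by (intro sum.cong refl) (simp only: weight[OF opt _ \<sigma>] rr_weight_eq[of s, OF s \<sigma>])
      then show ?thesis
        using \<open>1 \<le> I\<close> by simp
    qed
    with weight eq.optimal_attained show ?thesis
      by blast
  qed
  ultimately show ?thesis
    by blast
qed

end
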